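(* There is no collusion-proof mechanism for the path auction problem on general networks and two-values domains. The same remains true even if we restrict to coalitions of size three (in which two agents bribe another for misreporting her type).
   Context: Path auction problem: given a network (graph) with two distinguished nodes $s,t$, each edge is owned by a distinct agent; $N=\{1,\dots,n\}$, $n\ge2$. A feasible allocation is the $0/1$ indicator vector of the edges of an $s$–$t$ path: each agent on the selected path gets one unit of work, all others get zero. Agent $i$ has private type $\theta_i\in\Theta_i$, the cost of her edge. $\Theta=\Theta_1\times\cdots\times\Theta_n$; in a two-values domain $\Theta_i=\{L,H\}$ for all $i$, for two constants $L<H$. A mechanism is a pair $(A,p)$ where $A$ maps each reported type vector $\theta\in\Theta$ to a feasible allocation and $p:\Theta\to\mathbb{R}^n$ gives the payments to the agents. In the path auction problem the algorithm is required to select a shortest path, i.e. one minimizing $\sum_i A_i(\theta)\theta_i$, for every $\theta$. The utility of agent $k$ with type $\theta_k$ when $\hat\theta$ is reported is $u_k(\hat\theta;\theta_k)=p_k(\hat\theta)-A_k(\hat\theta)\theta_k$. A mechanism is collusion-proof if no coalition can improve its total utility by a joint misreport: for every $\theta\in\Theta$, every $C\subseteq N$ and every $\hat\theta\in\Theta$ differing from $\theta$ only in (some of) the types of agents in $C$, $\sum_{k\in C}u_k(\theta;\theta_k)\ge\sum_{k\in C}u_k(\hat\theta;\theta_k)$. In the restricted version, the inequality is required only for coalitions $C$ of size three and for $\hat\theta$ differing from $\theta$ only in the type of one member of $C$ (the one bribed by the other two).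
   Formalization: "Coalitions of size three" is read as size at most three (one member misreporting); with exactly three the claim is false on every network, since payments A_k(θ)θ_k − (1/3)Σ_l A_l(θ)θ_l make each such coalition's utility minus the true path cost. *)

theory Defs
  imports Complex_Main "HOL-Library.FuncSet"
begin

text \<open>
  A network is a finite simple undirected graph (an edge is a two-element set of nodes) with
  two distinguished nodes, in which agent \<open>i \<in> {1..n}\<close> owns the edge \<open>owned_edge G i\<close>.
\<close>

record 'v network =
  nodes :: "'v set"
  edges :: "'v set set"
  source :: 'v
  sink :: 'v
  num_agents :: nat
  owned_edge :: "nat \<Rightarrow> 'v set"

definition agents :: "'v network \<Rightarrow> nat set" where
  "agents G = {1..num_agents G}"

definition st_path :: "'v network \<Rightarrow> 'v list \<Rightarrow> bool" where
  "st_path G xs \<longleftrightarrow>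
     xs \<noteq> [] \<and> hd xs = source G \<and> last xs = sink G \<and> distinct xs \<and> set xs \<subseteq> nodes G \<and>
     (\<forall>k. Suc k < length xs \<longrightarrow> {xs ! k, xs ! Suc k} \<in> edges G)"

definition path_edges :: "'v list \<Rightarrow> 'v set set" where
  "path_edges xs = {{xs ! k, xs ! Suc k} | k. Suc k < length xs}"

text \<open>
  The last conjunct guarantees that there is a feasible allocation at all; without it the absence
  of mechanisms would be trivial.
\<close>

definition is_network :: "'v network \<Rightarrow> bool" where
  "is_network G \<longleftrightarrow>
     finite (nodes G) \<and>
     edges G \<subseteq> {{u, v} | u v. u \<in> nodes G \<and> v \<in> nodes G \<and> u \<noteq> v} \<and>
     source G \<in> nodes G \<and> sink G \<in> nodes G \<and> source G \<noteq> sink G \<and>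
     num_agents G \<ge> 2 \<and>
     bij_betw (owned_edge G) (agents G) (edges G) \<and>
     (\<exists>xs. st_path G xs)"

type_synonym profile = "nat \<Rightarrow> real"
type_synonym allocation = "nat \<Rightarrow> real"
type_synonym mechanism = "(profile \<Rightarrow> allocation) \<times> (profile \<Rightarrow> nat \<Rightarrow> real)"

definition feasible :: "'v network \<Rightarrow> allocation \<Rightarrow> bool" where
  "feasible G a \<longleftrightarrow>
     (\<exists>xs. st_path G xs \<and>
        (\<forall>i\<in>agents G. a i = (if owned_edge G i \<in> path_edges xs then 1 else 0)))"

text \<open>Profiles are extensional, so a mechanism sees nothing but the reports of the agents.\<close>

definition type_profiles :: "'v network \<Rightarrow> (nat \<Rightarrow> real set) \<Rightarrow> profile set" where
  "type_profiles G \<Theta> = (\<Pi>\<^sub>E i\<in>agents G. \<Theta> i)"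

definition two_values :: "real \<Rightarrow> real \<Rightarrow> nat \<Rightarrow> real set" where
  "two_values L H = (\<lambda>i. {L, H})"

definition total_cost :: "'v network \<Rightarrow> allocation \<Rightarrow> profile \<Rightarrow> real" where
  "total_cost G a \<theta> = (\<Sum>i\<in>agents G. a i * \<theta> i)"

definition path_auction_mechanism ::
  "'v network \<Rightarrow> (nat \<Rightarrow> real set) \<Rightarrow> mechanism \<Rightarrow> bool" where
  "path_auction_mechanism G \<Theta> M \<longleftrightarrow>
     (\<forall>\<theta>\<in>type_profiles G \<Theta>.
        feasible G (fst M \<theta>) \<and>
        (\<forall>a. feasible G a \<longrightarrow> total_cost G (fst M \<theta>) \<theta> \<le> total_cost G a \<theta>))"

definition utility :: "mechanism \<Rightarrow> nat \<Rightarrow> profile \<Rightarrow> real \<Rightarrow> real" where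
  "utility M k r t = snd M r k - fst M r k * t"

definition coalition_utility :: "mechanism \<Rightarrow> nat set \<Rightarrow> profile \<Rightarrow> profile \<Rightarrow> real" where
  "coalition_utility M C r \<theta> = (\<Sum>k\<in>C. utility M k r (\<theta> k))"

definition collusion_proof :: "'v network \<Rightarrow> (nat \<Rightarrow> real set) \<Rightarrow> mechanism \<Rightarrow> bool" where
  "collusion_proof G \<Theta> M \<longleftrightarrow>
     (\<forall>\<theta>\<in>type_profiles G \<Theta>. \<forall>C. C \<subseteq> agents G \<longrightarrow>
        (\<forall>r\<in>type_profiles G \<Theta>. (\<forall>j\<in>agents G - C. r j = \<theta> j) \<longrightarrow>
           coalition_utility M C \<theta> \<theta> \<ge> coalition_utility M C r \<theta>))"

text \<open>
  The restricted notion considers coalitions of \<^emph>\<open>up to\<close> three agents in which only one member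
  \<open>i\<close> misreports, being bribed by the (at most two) others. Counting only coalitions of
  \<^emph>\<open>exactly\<close> three agents would admit a mechanism on every network: with the payments
  \<open>p\<^sub>k(\<theta>) = A\<^sub>k(\<theta>) \<theta>\<^sub>k - (\<Sum>\<^sub>l A\<^sub>l(\<theta>) \<theta>\<^sub>l) / 3\<close> the utility of three agents is minus the true cost of the
  selected path, so that no such coalition gains from a misreport.
\<close>

definition collusion_proof_upto_three ::
  "'v network \<Rightarrow> (nat \<Rightarrow> real set) \<Rightarrow> mechanism \<Rightarrow> bool" where
  "collusion_proof_upto_three G \<Theta> M \<longleftrightarrow>
     (\<forall>\<theta>\<in>type_profiles G \<Theta>. \<forall>C. C \<subseteq> agents G \<and> card C \<le> 3 \<longrightarrow>
        (\<forall>i\<in>C. \<forall>r\<in>type_profiles G \<Theta>. (\<forall>j\<in>agents G - {i}. r j = \<theta> j) \<longrightarrow>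
           coalition_utility M C \<theta> \<theta> \<ge> coalition_utility M C r \<theta>))"

end

theory Submission
  imports Defs
begin

text \<open>
  Take the 4-cycle with \<open>s\<close> and \<open>t\<close> opposite: two disjoint paths of two edges each. An agent whose
  misreport does not change the selected path changes no payment, and any two profiles for which
  the same path is selected are linked by such single misreports; hence the payments depend only
  on the selected path. The payment differences between the two paths are then bounded by every
  single misreport that switches the path, and the bounds obtained when the remaining agents
  are cheap contradict those obtained when they are expensive, however ties are broken.
\<close>

text \<open>Encodes a two-valued profile by the set of agents with cost \<open>H\<close>. A
  misreport of agent \<open>i\<close> alone then reads \<open>S - {i} = T - {i}\<close>, and
  comparing paths of equal length amounts to counting expensive edges.\<close>

definition high_profile :: "'v network \<Rightarrow> real \<Rightarrow> real \<Rightarrow> nat set \<Rightarrow> profile" where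
  "high_profile G L H S = (\<lambda>i\<in>agents G. if i \<in> S then H else L)"

lemma high_profile_in [simp]: "high_profile G L H S \<in> type_profiles G (two_values L H)"
  by (auto simp: high_profile_def type_profiles_def two_values_def)

lemma high_profile_apply:
  "i \<in> agents G \<Longrightarrow> high_profile G L H S i = (if i \<in> S then H else L)"
  by (simp add: high_profile_def)

lemma collusion_proof_imp_upto_three:
  assumes "collusion_proof G \<Theta> M"
  shows "collusion_proof_upto_three G \<Theta> M"
  using assms unfolding collusion_proof_def collusion_proof_upto_three_def by blast

text \<open>\<open>S\<close> holds the true types and \<open>T\<close> the report. With the true
  costs written out, each instance for a concrete coalition becomes a linear inequality between
  payments.\<close>

lemma single_misreport:
  assumes "collusion_proof_upto_three G (two_values L H) M"
    and "i \<in> C" "C \<subseteq> agents G" "card C \<le> 3" "S - {i} = T - {i}"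
  shows "(\<Sum>k\<in>C. snd M (high_profile G L H T) k
             - fst M (high_profile G L H T) k * (if k \<in> S then H else L))
       \<le> (\<Sum>k\<in>C. snd M (high_profile G L H S) k
             - fst M (high_profile G L H S) k * (if k \<in> S then H else L))"
proof -
  have "\<forall>j\<in>agents G - {i}. high_profile G L H T j = high_profile G L H S j"
    using assms(5) by (auto simp: high_profile_apply)
  then have "coalition_utility M C (high_profile G L H T) (high_profile G L H S)
      \<le> coalition_utility M C (high_profile G L H S) (high_profile G L H S)"
    using assms(1-4) unfolding collusion_proof_upto_three_def by simp
  moreover have "coalition_utility M C r (high_profile G L H S)
      = (\<Sum>k\<in>C. snd M r k - fst M r k * (if k \<in> S then H else L))" for r
    unfolding coalition_utility_def utility_def
    using assms(3) by (intro sum.cong) (auto simp: high_profile_apply)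
  ultimately show ?thesis
    by simp
qed

text \<open>Equal work cancels, so exchanging truth and report turns the coalition inequality into
  an equation. The coalition \<open>{i}\<close> settles the payment to \<open>i\<close>; with that
  known, \<open>{i, k}\<close> settles the payment to \<open>k\<close>.\<close>

lemma payments_unchanged:
  assumes cp: "collusion_proof_upto_three G (two_values L H) M"
    and "i \<in> agents G" "k \<in> agents G" and ST: "S - {i} = T - {i}"
    and alloc: "\<And>j. j \<in> agents G \<Longrightarrow>
      fst M (high_profile G L H S) j = fst M (high_profile G L H T) j"
  shows "snd M (high_profile G L H S) k = snd M (high_profile G L H T) k"
proof -
  have i: "snd M (high_profile G L H S) i = snd M (high_profile G L H T) i"
    using single_misreport[OF cp, of i "{i}" S T] single_misreport[OF cp, of i "{i}" T S]
      assms(2) ST alloc by simp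
  show ?thesis
  proof (cases "k = i")
    case False
    then have "k \<in> S \<longleftrightarrow> k \<in> T"
      using ST by blast
    with False show ?thesis
      using single_misreport[OF cp, of i "{i, k}" S T] single_misreport[OF cp, of i "{i, k}" T S]
        assms(2,3) ST alloc i by simp
  qed (use i in simp)
qed

text \<open>One path belongs to \<open>a, b\<close>, the other to \<open>c, d\<close>. Optimality is
  stated by counting because both paths have two edges. The assumption \<open>low\<close> fixes how
  the tie at the all-cheap profile is broken; the opposite choice is covered by exchanging the
  paths.\<close>

lemma no_mechanism_two_paths:
  assumes "L < H" and cp: "collusion_proof_upto_three G (two_values L H) M"
    and ag: "agents G = {a, b, c, d}" and dist: "distinct [a, b, c, d]"
    and sel: "\<And>S. fst M (high_profile G L H S) a = 1 \<and> fst M (high_profile G L H S) b = 1 \<and>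
          fst M (high_profile G L H S) c = 0 \<and> fst M (high_profile G L H S) d = 0 \<or>
        fst M (high_profile G L H S) a = 0 \<and> fst M (high_profile G L H S) b = 0 \<and>
          fst M (high_profile G L H S) c = 1 \<and> fst M (high_profile G L H S) d = 1"
    and ab_opt: "\<And>S. fst M (high_profile G L H S) a = 1 \<Longrightarrow>
      card (S \<inter> {a, b}) \<le> card (S \<inter> {c, d})"
    and cd_opt: "\<And>S. fst M (high_profile G L H S) a = 0 \<Longrightarrow>
      card (S \<inter> {c, d}) \<le> card (S \<inter> {a, b})"
    and low: "fst M (high_profile G L H {}) a = 1"
  shows False
proof -
  define A where "A S = fst M (high_profile G L H S)" for S
  define p where "p S = snd M (high_profile G L H S)" for S
  have ne [simp]: "a \<noteq> b" "a \<noteq> c" "a \<noteq> d" "b \<noteq> c" "b \<noteq> d" "c \<noteq> d"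
    "b \<noteq> a" "c \<noteq> a" "d \<noteq> a" "c \<noteq> b" "d \<noteq> b" "d \<noteq> c"
    using dist by auto
  have sel': "A S a = 1 \<and> A S b = 1 \<and> A S c = 0 \<and> A S d = 0 \<or>
      A S a = 0 \<and> A S b = 0 \<and> A S c = 1 \<and> A S d = 1" for S
    using sel[of S] unfolding A_def .
  have up: "A S b = 1 \<and> A S c = 0 \<and> A S d = 0" if "A S a = 1" for S
    using sel'[of S] that by auto
  have down: "A S b = 0 \<and> A S c = 1 \<and> A S d = 1" if "A S a = 0" for S
    using sel'[of S] that by auto
  have strict_up: "A S a = 1" if "card (S \<inter> {a, b}) < card (S \<inter> {c, d})" for S
    using sel'[of S] cd_opt[of S] that unfolding A_def by fastforce
  have strict_down: "A S a = 0" if "card (S \<inter> {c, d}) < card (S \<inter> {a, b})" for S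
    using sel'[of S] ab_opt[of S] that unfolding A_def by fastforce
  have unchanged: "p S k = p T k"
    if "A S a = A T a" "S - {i} = T - {i}" "i \<in> {a, b, c, d}" "k \<in> {a, b, c, d}" for S T i k
    unfolding p_def
  proof (rule payments_unchanged[OF cp])
    show "fst M (high_profile G L H S) j = fst M (high_profile G L H T) j" if "j \<in> agents G" for j
      using sel'[of S] sel'[of T] \<open>A S a = A T a\<close> that unfolding ag A_def by auto
  qed (use that ag in auto)
  have ineq: "(\<Sum>k\<in>C. p T k - A T k * (if k \<in> S then H else L))
      \<le> (\<Sum>k\<in>C. p S k - A S k * (if k \<in> S then H else L))"
    if "i \<in> C" "C \<subseteq> {a, b, c, d}" "card C \<le> 3" "S - {i} = T - {i}" for i C S T
    unfolding p_def A_def using single_misreport[OF cp that(1) _ that(3,4)] that(2) ag by simp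
  have A0: "A {} a = 1"
    using low by (simp add: A_def)
  \<comment> \<open>Of the profiles used below, only \<open>{}\<close> and
    \<open>{a, b, c, d}\<close> are ties. All others determine the selected path.\<close>
  have A1: "A {c} a = 1" "A {c, d} a = 1" "A {b, c, d} a = 1"
    by (auto intro!: strict_up)
  have A2: "A {a} a = 0" "A {b} a = 0" "A {a, b} a = 0" "A {a, b, d} a = 0"
    by (auto intro!: strict_down)
  \<comment> \<open>Raise \<open>c\<close>, \<open>d\<close> and \<open>b\<close> in this order: the
    path \<open>a, b\<close> stays selected throughout.\<close>
  have P: "p {c} k = p {} k" "p {c, d} k = p {} k" "p {b, c, d} k = p {} k"
    if "k \<in> {a, b, c, d}" for k
  proof -
    show 1: "p {c} k = p {} k"
      by (rule unchanged[of _ _ c]) (use A0 A1 that in auto)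
    have "p {c, d} k = p {c} k"
      by (rule unchanged[of _ _ d]) (use A1 that in auto)
    with 1 show 2: "p {c, d} k = p {} k"
      by simp
    have "p {b, c, d} k = p {c, d} k"
      by (rule unchanged[of _ _ b]) (use A1 that in auto)
    with 2 show "p {b, c, d} k = p {} k"
      by simp
  qed
  \<comment> \<open>\<open>{a}\<close> and \<open>{b}\<close> differ in two reports, so they are
    linked through \<open>{a, b}\<close>.\<close>
  have Q: "p {b} k = p {a} k" "p {a, b, d} k = p {a} k" if "k \<in> {a, b, c, d}" for k
  proof -
    have 1: "p {a, b} k = p {a} k"
      by (rule unchanged[of _ _ b]) (use A2 that in auto)
    have "p {a, b} k = p {b} k"
      by (rule unchanged[of _ _ a]) (use A2 that in auto)
    with 1 show "p {b} k = p {a} k"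
      by simp
    have "p {a, b, d} k = p {a, b} k"
      by (rule unchanged[of _ _ d]) (use A2 that in auto)
    with 1 show "p {a, b, d} k = p {a} k"
      by simp
  qed
  \<comment> \<open>All are cheap and \<open>a\<close> overstates, which moves the selection to
    \<open>c, d\<close>. Write \<open>D k\<close> for \<open>p {a} k - p {} k\<close>, the payment
    gain of \<open>k\<close> from this switch. The bound says that \<open>D a + D c + D d\<close> is
    at most \<open>L\<close>.\<close>
  have acd: "p {a} a + p {a} c + p {a} d - L \<le> p {} a + p {} c + p {} d"
    using ineq[of a "{a, c, d}" "{}" "{a}"] up[OF A0] down[OF A2(1)] A0 A2(1) by simp
  \<comment> \<open>The tie at the all-expensive profile can be broken either way.\<close>
  consider "A {a, b, c, d} a = 1" | "A {a, b, c, d} a = 0"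
    using sel' by blast
  then show False
  proof cases
    case 1
    have all: "p {a, b, c, d} k = p {} k" if "k \<in> {a, b, c, d}" for k
    proof -
      have "p {a, b, c, d} k = p {b, c, d} k"
        by (rule unchanged[of _ _ a]) (use 1 A1 that in auto)
      with P that show ?thesis
        by simp
    qed
    \<comment> \<open>The same bound with \<open>b\<close> as the one who overstates.\<close>
    have bcd: "p {a} b + p {a} c + p {a} d - L \<le> p {} b + p {} c + p {} d"
      using ineq[of b "{b, c, d}" "{}" "{b}"] up[OF A0] down[OF A2(2)] A0 A2(2) Q(1) by simp
    \<comment> \<open>Here \<open>a\<close> is truly expensive and understates, with
      \<open>b\<close> in the coalition: \<open>D a + D b\<close> is at least
      \<open>- L - H\<close>.\<close>
    have ab: "p {} a + p {} b - L - H \<le> p {a} a + p {a} b"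
      using ineq[of a "{a, b}" "{a}" "{}"] up[OF A0] down[OF A2(1)] A0 A2(1) by simp
    have diff_c: "{a, b, d} - {c} = {a, b, c, d} - {c}"
      by auto
    \<comment> \<open>Only \<open>c\<close> is truly cheap and overstates; the resulting tie goes to
      \<open>a, b\<close> in this case. Hence \<open>D c + D d\<close> is at least
      \<open>L + H\<close>.\<close>
    have cd: "p {} c + p {} d \<le> p {a} c + p {a} d - L - H"
      using ineq[of c "{c, d}", OF _ _ _ diff_c] up[OF 1] down[OF A2(4)]
        1 A2(4) all Q(2) by simp
    \<comment> \<open>Adding \<open>acd\<close> and \<open>bcd\<close> bounds
      \<open>D a + D b + 2 * (D c + D d)\<close> above by \<open>2 * L\<close>; \<open>ab\<close>
      and twice \<open>cd\<close> bound it below by \<open>L + H\<close>.\<close>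
    from acd bcd ab cd show False
      using \<open>L < H\<close> by linarith
  next
    case 2
    have all: "p {a, b, c, d} k = p {a} k" if "k \<in> {a, b, c, d}" for k
    proof -
      have "p {a, b, c, d} k = p {a, b, d} k"
        by (rule unchanged[of _ _ c]) (use 2 A2 that in auto)
      with Q that show ?thesis
        by simp
    qed
    have diff_a: "{a, b, c, d} - {a} = {b, c, d} - {a}"
      by auto
    \<comment> \<open>All are expensive and \<open>a\<close> understates, which moves the selection
      to \<open>a, b\<close>. So \<open>D a + D c + D d\<close> is at least \<open>H\<close>,
      against the bound \<open>L\<close> in \<open>acd\<close>.\<close>
    have "p {} a + p {} c + p {} d \<le> p {a} a + p {a} c + p {a} d - H"
      using ineq[of a "{a, c, d}", OF _ _ _ diff_a] up[OF A1(3)] down[OF 2]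
        2 A1(3) all P(3) by simp
    with acd show False
      using \<open>L < H\<close> by linarith
  qed
qed

definition four_cycle :: "nat network" where
  "four_cycle = \<lparr>nodes = {0, 1, 2, 3}, edges = {{0, 1}, {1, 3}, {0, 2}, {2, 3}},
     source = 0, sink = 3, num_agents = 4,
     owned_edge = (\<lambda>i. if i = 1 then {0, 1} else if i = 2 then {1, 3}
                       else if i = 3 then {0, 2} else {2, 3})\<rparr>"

lemma agents_four_cycle: "agents four_cycle = {1, 2, 3, 4}"
  by (auto simp: agents_def four_cycle_def)

lemma st_path_four_cycle: "st_path four_cycle xs \<longleftrightarrow> xs = [0, 1, 3] \<or> xs = [0, 2, 3]"
proof
  assume st: "st_path four_cycle xs"
  then have dist: "distinct xs" and sub: "set xs \<subseteq> {0, 1, 2, 3}" and hd: "hd xs = 0"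
    and last: "last xs = 3" and "xs \<noteq> []"
    and step: "\<And>k. Suc k < length xs \<Longrightarrow>
      {xs ! k, xs ! Suc k} \<in> {{0, 1}, {1, 3}, {0, 2}, {2, 3}}"
    by (auto simp: st_path_def four_cycle_def)
  obtain ys where xs: "xs = 0 # ys"
    using hd \<open>xs \<noteq> []\<close> by (cases xs) auto
  with last obtain y zs where ys: "ys = y # zs"
    by (cases ys) auto
  have y: "y = 1 \<or> y = 2"
    using step[of 0] by (auto simp: xs ys doubleton_eq_iff)
  with last obtain z ws where zs: "zs = z # ws"
    by (cases zs) (auto simp: xs ys)
  \<comment> \<open>The only other neighbour of \<open>y\<close> is the source, which a path cannot
    revisit.\<close>
  have z: "z = 3"
    using step[of 1] y dist by (auto simp: xs ys zs doubleton_eq_iff)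
  have "ws = []"
    using last dist z by (cases ws rule: rev_cases) (auto simp: xs ys zs)
  with y z show "xs = [0, 1, 3] \<or> xs = [0, 2, 3]"
    by (auto simp: xs ys zs)
next
  assume "xs = [0, 1, 3] \<or> xs = [0, 2, 3]"
  then show "st_path four_cycle xs"
    by (elim disjE) (simp_all add: st_path_def four_cycle_def numeral_3_eq_3 All_less_Suc)
qed

lemma path_edges_three: "path_edges [u, v, w] = {{u, v}, {v, w}}"
proof -
  have "{k. Suc k < length [u, v, w]} = {0, 1}"
    by auto
  then have "path_edges [u, v, w] = (\<lambda>k. {[u, v, w] ! k, [u, v, w] ! Suc k}) ` {0, 1}"
    unfolding path_edges_def by blast
  then show ?thesis
    by simp
qed

lemma feasible_four_cycle:
  "feasible four_cycle x \<longleftrightarrow>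
     x 1 = 1 \<and> x 2 = 1 \<and> x 3 = 0 \<and> x 4 = 0 \<or> x 1 = 0 \<and> x 2 = 0 \<and> x 3 = 1 \<and> x 4 = 1"
proof -
  have "feasible four_cycle x \<longleftrightarrow> (\<exists>xs\<in>{[0, 1, 3], [0, 2, 3]}.
      \<forall>i\<in>{1, 2, 3, 4}. x i = (if owned_edge four_cycle i \<in> path_edges xs then 1 else 0))"
    unfolding feasible_def st_path_four_cycle agents_four_cycle by blast
  then show ?thesis
    by (simp add: path_edges_three four_cycle_def doubleton_eq_iff)
qed

lemma is_network_four_cycle: "is_network four_cycle"
proof -
  have "bij_betw (owned_edge four_cycle) (agents four_cycle) (edges four_cycle)"
    unfolding agents_four_cycle bij_betw_def
    by (auto simp: four_cycle_def inj_on_def doubleton_eq_iff)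
  moreover have "edges four_cycle \<subseteq>
      {{u, v} | u v. u \<in> nodes four_cycle \<and> v \<in> nodes four_cycle \<and> u \<noteq> v}"
  proof -
    have "{u, v} \<in> {{u, v} | u v. u \<in> nodes four_cycle \<and> v \<in> nodes four_cycle \<and> u \<noteq> v}"
      if "u \<in> {0, 1, 2, 3}" "v \<in> {0, 1, 2, 3}" "u \<noteq> v" for u v
      using that by (auto simp: four_cycle_def)
    then show ?thesis
      by (simp add: four_cycle_def)
  qed
  moreover have "\<exists>xs. st_path four_cycle xs"
    using st_path_four_cycle by blast
  ultimately show ?thesis
    by (simp add: is_network_def four_cycle_def)
qed

lemma no_mechanism_four_cycle:
  assumes "L < H" and mech: "path_auction_mechanism four_cycle (two_values L H) M"
    and cp: "collusion_proof_upto_three four_cycle (two_values L H) M"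
  shows False
proof -
  let ?A = "\<lambda>S. fst M (high_profile four_cycle L H S)"
  have sel: "?A S 1 = 1 \<and> ?A S 2 = 1 \<and> ?A S 3 = 0 \<and> ?A S 4 = 0 \<or>
      ?A S 1 = 0 \<and> ?A S 2 = 0 \<and> ?A S 3 = 1 \<and> ?A S 4 = 1" for S
    using mech unfolding path_auction_mechanism_def feasible_four_cycle by simp
  have cost: "total_cost four_cycle x (high_profile four_cycle L H S) =
      (\<Sum>i\<in>{1, 2, 3, 4}. x i * (if i \<in> S then H else L))" for x S
    unfolding total_cost_def agents_four_cycle
    by (intro sum.cong) (auto simp: high_profile_apply agents_four_cycle)
  have opt: "(\<Sum>i\<in>{1, 2, 3, 4}. ?A S i * (if i \<in> S then H else L))
      \<le> (\<Sum>i\<in>{1, 2, 3, 4}. x i * (if i \<in> S then H else L))"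
    if "feasible four_cycle x" for x S
    using mech that unfolding path_auction_mechanism_def cost[symmetric] by simp
  \<comment> \<open>Compare with the allocation of the other path: the costs differ by
    \<open>H - L\<close> times the difference in the numbers of expensive edges.\<close>
  have opt12: "card (S \<inter> {1, 2}) \<le> card (S \<inter> {3, 4})" if "?A S 1 = 1" for S
    using opt[of "\<lambda>i. if i \<in> {3, 4} then 1 else 0" S] sel[of S] that \<open>L < H\<close>
    by (auto simp: feasible_four_cycle Int_insert_right split: if_splits)
  have opt34: "card (S \<inter> {3, 4}) \<le> card (S \<inter> {1, 2})" if "?A S 1 = 0" for S
    using opt[of "\<lambda>i. if i \<in> {1, 2} then 1 else 0" S] sel[of S] that \<open>L < H\<close>
    by (auto simp: feasible_four_cycle Int_insert_right split: if_splits)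
  \<comment> \<open>This reordering lets the paths trade roles when the all-cheap tie goes to agents
    3 and 4.\<close>
  have ag: "agents four_cycle = {3, 4, 1, 2}"
    by (auto simp: agents_four_cycle)
  consider "?A {} 1 = 1" | "?A {} 3 = 1"
    using sel by blast
  then show False
  proof cases
    case 1
    show False
      by (rule no_mechanism_two_paths[OF \<open>L < H\<close> cp agents_four_cycle])
        (use sel opt12 opt34 1 in auto)
  next
    case 2
    have "?A S 1 = 0" if "?A S 3 = 1" for S
      using sel[of S] that by auto
    moreover have "?A S 1 = 1" if "?A S 3 = 0" for S
      using sel[of S] that by auto
    moreover have "?A S 3 = 1 \<and> ?A S 4 = 1 \<and> ?A S 1 = 0 \<and> ?A S 2 = 0 \<or>
        ?A S 3 = 0 \<and> ?A S 4 = 0 \<and> ?A S 1 = 1 \<and> ?A S 2 = 1" for S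
      using sel[of S] by auto
    ultimately show False
      by (intro no_mechanism_two_paths[OF \<open>L < H\<close> cp ag])
        (use opt12 opt34 2 in auto)
  qed
qed

theorem corollary17:
  fixes L H :: real
  assumes "L < H"
  shows "(\<exists>G :: nat network. is_network G \<and>
            \<not> (\<exists>M. path_auction_mechanism G (two_values L H) M \<and>
                   collusion_proof G (two_values L H) M)) \<and>
         (\<exists>G :: nat network. is_network G \<and>
            \<not> (\<exists>M. path_auction_mechanism G (two_values L H) M \<and>
                   collusion_proof_upto_three G (two_values L H) M))"
  using is_network_four_cycle no_mechanism_four_cycle[OF assms] collusion_proof_imp_upto_three
  by blast

end
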